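(* Let $N\ge1$, $g>0$, $h>0$, and let $A_H\in\mathbb{R}^{(2N+3)\times(2N+3)}$ be the $x$-direction coefficient matrix of the HSWME (defined in the context). Suppose $\alpha_1\ne0$. Then $A_H$ is diagonalizable over $\mathbb{R}$. Its characteristic polynomial is $$\det(xI-A_H)=\frac{N!\,(N+1)!}{((2N+1)!!)^2}\,\alpha_1^{2N+1}\,P_{N+1}'\!\left(\frac{x-u_m}{\alpha_1}\right)P_{N+1}\!\left(\frac{x-u_m}{\alpha_1}\right)\left((x-u_m)^2-gh-\alpha_1^2\right).$$ Moreover, the eigenvalues are $$\lambda_{1,2}=u_m\pm\sqrt{gh+\alpha_1^2},\qquad \lambda_{i+2}=u_m+r_i\alpha_1\ (i=1,\dots,N),\qquad \lambda_{i+N+2}=u_m+s_i\alpha_1\ (i=1,\dots,N+1),$$ where $r_1,\dots,r_N$ are the roots of $P_{N+1}'(\xi)$ and $s_1,\dots,s_{N+1}$ are the roots of $P_{N+1}(\xi)$. Here $P_n$ is the $n$-th Legendre polynomial on $[-1,1]$ with $P_n(1)=1$.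
   Context: The matrix $A_H$ acts on the variables $U=(h,hu_m,hv_m,h\alpha_1,h\beta_1,\dots,h\alpha_N,h\beta_N)^T$, and depends only on $h,u_m,v_m,\alpha_1,\beta_1\in\mathbb{R}$ and the constant $g$. Index rows and columns by one scalar index (for $h$) followed by $2\times2$-block indices $0,1,\dots,N$ (block $0$ for $(hu_m,hv_m)$, block $i$ for $(h\alpha_i,h\beta_i)$). All entries not listed are $0$; blocks with index exceeding $N$ are omitted. Scalar row: $0$ in the scalar column, $(1,0)$ in block column $0$. Scalar column: block row $0$: $\left(-u_m^2-\frac{\alpha_1^2}{3}+gh,\ -u_mv_m-\frac{\alpha_1\beta_1}{3}\right)^T$; block row $1$: $\left(-2u_m\alpha_1,\ -(u_m\beta_1+v_m\alpha_1)\right)^T$; block row $2$: $\left(-\frac23\alpha_1^2,\ -\frac23\alpha_1\beta_1\right)^T$. Blocks $E_{ij}$ (block row $i$, block column $j$): $$E_{00}=\begin{pmatrix} 2u_m & 0 \\ v_m & u_m \end{pmatrix},\quad E_{ii}=\begin{pmatrix} u_m & 0 \\ 0 & u_m \end{pmatrix}\ (1\le i\le N),\quad E_{i,i+1}=\begin{pmatrix} \frac{i+2}{2i+3}\alpha_1 & 0 \\ \frac{1}{2i+3}\beta_1 & \frac{i+1}{2i+3}\alpha_1 \end{pmatrix}\ (0\le i\le N-1),$$ $$E_{10}=\begin{pmatrix} 2\alpha_1 & 0 \\ \beta_1 & \alpha_1 \end{pmatrix},\quad E_{i,i-1}=\begin{pmatrix} \frac{i-1}{2i-1}\alpha_1 &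 0 \\ -\frac{1}{2i-1}\beta_1 & \frac{i}{2i-1}\alpha_1 \end{pmatrix}\ (2\le i\le N).$$ $(2N+1)!!=1\cdot3\cdots(2N+1)$. *)

theory Defs
  imports "HOL-Analysis.Analysis" "Jordan_Normal_Form.Spectral_Radius"
begin

hide_const (open) module.smult

section \<open>Legendre polynomials\<close>

definition is_legendre :: "nat \<Rightarrow> real poly \<Rightarrow> bool" where
  "is_legendre n p \<longleftrightarrow> degree p = n
     \<and> (\<forall>q. degree q < n \<longrightarrow> integral {-1..1} (\<lambda>x. poly p x * poly q x) = 0)
     \<and> poly p 1 = 1"

text \<open>Well defined: see \<open>is_legendre_iff\<close> below.\<close>

definition legendre :: "nat \<Rightarrow> real poly" where
  "legendre n = (THE p. is_legendre n p)"

subsection \<open>Existence and uniqueness, via Bonnet's recursion\<close>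

fun bonnet :: "nat \<Rightarrow> real poly" where
  "bonnet 0 = 1"
| "bonnet (Suc 0) = [:0, 1:]"
| "bonnet (Suc (Suc n)) =
     smult (1 / (real n + 2))
       (smult (2 * real n + 3) ([:0, 1:] * bonnet (Suc n)) - smult (real n + 1) (bonnet n))"

lemma bonnet_rec:
  "smult (real n + 2) (bonnet (Suc (Suc n))) =
     smult (2 * real n + 3) ([:0, 1:] * bonnet (Suc n)) - smult (real n + 1) (bonnet n)"
proof -
  have "real n + 2 \<noteq> 0" by linarith
  then show ?thesis by (simp del: mult_pCons_left)
qed

lemma poly_bonnet_rec:
  "(real n + 2) * poly (bonnet (Suc (Suc n))) x =
     (2 * real n + 3) * x * poly (bonnet (Suc n)) x - (real n + 1) * poly (bonnet n) x"
  using arg_cong[OF bonnet_rec[of n], of "\<lambda>p. poly p x"] by (simp del: bonnet.simps add: algebra_simps)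

lemma poly_pderiv_bonnet_rec:
  "(real n + 2) * poly (pderiv (bonnet (Suc (Suc n)))) x =
     (2 * real n + 3) * (poly (bonnet (Suc n)) x + x * poly (pderiv (bonnet (Suc n))) x)
       - (real n + 1) * poly (pderiv (bonnet n)) x"
  using arg_cong[OF bonnet_rec[of n], of "\<lambda>p. poly (pderiv p) x"]
  by (simp del: bonnet.simps
      add: pderiv_smult pderiv_diff pderiv_mult pderiv_pCons algebra_simps)

lemma bonnet_at_1: "poly (bonnet n) 1 = 1"
proof (induction n rule: bonnet.induct)
  case (3 n)
  have "(real n + 2) * poly (bonnet (Suc (Suc n))) 1 = real n + 2"
    using poly_bonnet_rec[of n 1] 3 by (simp del: bonnet.simps)
  then show ?case by (simp del: bonnet.simps add: add_eq_0_iff)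
qed auto

lemma bonnet_coeffs: "coeff (bonnet n) n > 0 \<and> (\<forall>i>n. coeff (bonnet n) i = 0)"
proof (induction n rule: bonnet.induct)
  case (3 n)
  then show ?case
    by (auto simp: coeff_pCons split: nat.splits intro!: divide_pos_pos mult_pos_pos)
qed (auto simp: coeff_pCons split: nat.splits)

lemma degree_bonnet: "degree (bonnet n) = n"
  using bonnet_coeffs[of n] by (metis degree_le le_antisym le_degree less_irrefl)

lemma bonnet_deriv:
  "poly (pderiv (bonnet (Suc n))) x
     = x * poly (pderiv (bonnet n)) x + (real n + 1) * poly (bonnet n) x
   \<and> x * poly (pderiv (bonnet (Suc n))) x
     = poly (pderiv (bonnet n)) x + (real n + 1) * poly (bonnet (Suc n)) x"
proof (induction n)
  case 0
  then show ?case by (simp add: pderiv_pCons)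
next
  case (Suc n)
  define p q r p' q' r' where defs:
    "p = poly (bonnet n) x" "q = poly (bonnet (Suc n)) x" "r = poly (bonnet (Suc (Suc n))) x"
    "p' = poly (pderiv (bonnet n)) x" "q' = poly (pderiv (bonnet (Suc n))) x"
    "r' = poly (pderiv (bonnet (Suc (Suc n)))) x"
  have a: "q' = x * p' + (real n + 1) * p" and b: "x * q' = p' + (real n + 1) * q"
    using Suc unfolding defs by auto
  have d: "(real n + 2) * r' = (2 * real n + 3) * (q + x * q') - (real n + 1) * p'"
    and e: "(real n + 2) * r = (2 * real n + 3) * x * q - (real n + 1) * p"
    using poly_pderiv_bonnet_rec[of n x] poly_bonnet_rec[of n x] unfolding defs by auto
  have "(real n + 2) * r' = (real n + 2) * (x * q' + (real n + 2) * q)"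
    unfolding d b by (simp add: algebra_simps)
  then have 1: "r' = x * q' + (real n + 2) * q"
    by (simp add: add_eq_0_iff)
  have "x * r' = x * (p' + (real n + 1) * q) + (real n + 2) * x * q"
    unfolding 1 b[symmetric] by (simp add: algebra_simps)
  then have 2: "x * r' = q' + (real n + 2) * r"
    unfolding a e by (simp add: algebra_simps)
  show ?case using 1 2 unfolding defs by (simp del: bonnet.simps add: algebra_simps)
qed

lemma bonnet_ode:
  "pderiv ([:-1, 0, 1:] * pderiv (bonnet n)) = smult (real n * (real n + 1)) (bonnet n)"
proof (cases n)
  case 0
  then show ?thesis by simp
next
  case (Suc m)
  have eq: "[:-1, 0, 1:] * pderiv (bonnet n)
      = smult (real n) ([:0, 1:] * bonnet n - bonnet m)"
  proof (rule poly_eq_poly_eq_iff[THEN iffD1, OF ext])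
    fix x :: real
    show "poly ([:-1, 0, 1:] * pderiv (bonnet n)) x
        = poly (smult (real n) ([:0, 1:] * bonnet n - bonnet m)) x"
    proof -
      define p q p' q' where defs: "p = poly (bonnet m) x" "q = poly (bonnet (Suc m)) x"
        "p' = poly (pderiv (bonnet m)) x" "q' = poly (pderiv (bonnet (Suc m))) x"
      have a: "q' = x * p' + (real m + 1) * p" and b: "x * q' = p' + (real m + 1) * q"
        using bonnet_deriv[of m x] unfolding defs by auto
      have "(x * x - 1) * q' = x * (x * q') - q'"
        by (simp add: algebra_simps)
      also have "\<dots> = (real m + 1) * (x * q - p)"
        unfolding b unfolding a by (simp add: algebra_simps)
      finally show ?thesis
        unfolding Suc defs by (simp del: bonnet.simps add: algebra_simps)
    qed
  qed
  show ?thesis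
  proof (rule poly_eq_poly_eq_iff[THEN iffD1, OF ext])
    fix x :: real
    show "poly (pderiv ([:-1, 0, 1:] * pderiv (bonnet n))) x
        = poly (smult (real n * (real n + 1)) (bonnet n)) x"
      using conjunct2[OF bonnet_deriv[of m x]] unfolding eq unfolding Suc
      by (simp del: bonnet.simps
          add: pderiv_smult pderiv_diff pderiv_mult pderiv_pCons algebra_simps)
  qed
qed

lemma integrable_poly: "(\<lambda>x. poly p x) integrable_on {-1..1::real}"
  by (intro integrable_continuous_interval continuous_intros)

lemma integral_pderiv:
  "integral {-1..1} (\<lambda>x. poly (pderiv p) x) = poly p 1 - poly p (-1::real)"
  by (intro integral_unique fundamental_theorem_of_calculus)
    (auto intro!: DERIV_subset[OF poly_DERIV]
      simp flip: has_real_derivative_iff_has_vector_derivative)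

lemma bonnet_orthogonal:
  assumes "m \<noteq> n"
  shows "integral {-1..1} (\<lambda>x. poly (bonnet n * bonnet m) x) = 0"
proof -
  let ?c = "real n * (real n + 1) - real m * (real m + 1)"
  let ?w = "[:-1, 0, 1:] :: real poly"
  let ?F = "(?w * pderiv (bonnet n)) * bonnet m - (?w * pderiv (bonnet m)) * bonnet n"
  have "?c = (real n - real m) * (real n + real m + 1)"
    by (simp add: algebra_simps)
  moreover have "real n + real m + 1 \<noteq> 0" by linarith
  ultimately have c: "?c \<noteq> 0" using assms by simp
  have "pderiv ?F = smult ?c (bonnet n * bonnet m)"
    unfolding pderiv_diff pderiv_mult[of "?w * pderiv (bonnet n)"]
      pderiv_mult[of "?w * pderiv (bonnet m)"] bonnet_ode
    by (simp del: mult_pCons_left add: algebra_simps smult_diff_left)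
  then have "integral {-1..1} (\<lambda>x. poly (smult ?c (bonnet n * bonnet m)) x) = 0"
    using integral_pderiv[of ?F] by simp
  then show ?thesis using c by simp
qed

lemma bonnet_orthogonal_lower:
  assumes "m \<le> n" and "\<And>i. i \<ge> m \<Longrightarrow> coeff q i = 0"
  shows "integral {-1..1} (\<lambda>x. poly (bonnet n * q) x) = 0"
  using assms
proof (induction m arbitrary: q)
  case 0
  then have "q = 0" by (intro poly_eqI) auto
  then show ?case by simp
next
  case (Suc m)
  define c where "c = coeff q m / coeff (bonnet m) m"
  define r where "r = q - smult c (bonnet m)"
  have "coeff r i = 0" if "i \<ge> m" for i
    using that Suc.prems(2)[of i] bonnet_coeffs[of m]
    by (cases "i = m") (auto simp: r_def c_def)
  then have r: "integral {-1..1} (\<lambda>x. poly (bonnet n * r) x) = 0"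
    using Suc by simp
  have "(\<lambda>x. poly (bonnet n * q) x)
      = (\<lambda>x. poly (bonnet n * r) x + c * poly (bonnet n * bonnet m) x)"
    by (auto simp: r_def algebra_simps)
  then have "integral {-1..1} (\<lambda>x. poly (bonnet n * q) x)
      = integral {-1..1} (\<lambda>x. poly (bonnet n * r) x)
        + c * integral {-1..1} (\<lambda>x. poly (bonnet n * bonnet m) x)"
    by (simp add: integral_add integrable_poly integrable_on_mult_right del: poly_mult)
  also have "\<dots> = 0"
    using r bonnet_orthogonal[of m n] Suc.prems(1) by simp
  finally show ?case .
qed

lemma is_legendre_bonnet: "is_legendre n (bonnet n)"
  unfolding is_legendre_def
proof (intro conjI allI impI)
  fix q :: "real poly" assume "degree q < n"
  then show "integral {-1..1} (\<lambda>x. poly (bonnet n) x * poly q x) = 0"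
    using bonnet_orthogonal_lower[of n n q] by (simp add: coeff_eq_0)
qed (auto simp: degree_bonnet bonnet_at_1)

lemma is_legendre_unique:
  assumes p: "is_legendre n p" and q: "is_legendre n q"
  shows "p = q"
proof -
  define c where "c = lead_coeff p / lead_coeff q"
  define d where "d = p - smult c q"
  have deg: "degree p = n" "degree q = n" and one: "poly p 1 = 1" "poly q 1 = 1"
    using p q by (auto simp: is_legendre_def)
  have "q \<noteq> 0" using one by auto
  have "d = 0"
  proof (rule ccontr)
    assume d: "d \<noteq> 0"
    have "coeff d i = 0" if "i \<ge> n" for i
      using that deg \<open>q \<noteq> 0\<close> leading_coeff_0_iff[of q]
      by (cases "i = n") (auto simp: d_def c_def coeff_eq_0 simp del: leading_coeff_0_iff)
    then have "degree d < n"
      using d by (metis leading_coeff_0_iff not_le)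
    then have "integral {-1..1} (\<lambda>x. poly (p * d) x) = 0" "integral {-1..1} (\<lambda>x. poly (q * d) x) = 0"
      using p q by (auto simp: is_legendre_def)
    moreover have "(\<lambda>x. poly (d * d) x) = (\<lambda>x. poly (p * d) x - c * poly (q * d) x)"
      by (auto simp: d_def algebra_simps)
    ultimately have int0: "integral {-1..1} (\<lambda>x. poly (d * d) x) = 0"
      by (simp add: integral_diff integrable_poly integrable_on_mult_right del: poly_mult)
    have "poly (d * d) x = 0" if "x \<in> {-1..1}" for x
    proof -
      have "((\<lambda>x. poly (d * d) x) has_integral 0) (cbox (-1) 1)"
        using integrable_integral[OF integrable_poly[of "d * d"]] int0 by simp
      then show ?thesis
        by (rule has_integral_0_cbox_imp_0[rotated 2])
          (use that in \<open>auto intro!: continuous_intros\<close>)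
    qed
    then have "{-1..1} \<subseteq> {x. poly d x = 0}" by auto
    then have "finite {-1..1::real}"
      using poly_roots_finite[OF d] finite_subset by blast
    then show False
      using infinite_Icc[of "-1::real" 1] by simp
  qed
  then have "p = smult c q" by (simp add: d_def)
  moreover from this have "c = 1" using one by simp
  ultimately show ?thesis by simp
qed

lemma legendre_eq_bonnet: "legendre n = bonnet n"
  unfolding legendre_def
  by (rule the_equality) (auto intro: is_legendre_bonnet is_legendre_unique)

lemma is_legendre_iff: "is_legendre n p \<longleftrightarrow> p = legendre n"
  unfolding legendre_eq_bonnet using is_legendre_bonnet is_legendre_unique by blast


section \<open>The HSWME coefficient matrix\<close>

abbreviation mat2 :: "real \<Rightarrow> real \<Rightarrow> real \<Rightarrow> real \<Rightarrow> real mat" where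
  "mat2 a b c d \<equiv> mat_of_rows_list 2 [[a, b], [c, d]]"

definition hswme_block :: "real \<Rightarrow> real \<Rightarrow> real \<Rightarrow> real \<Rightarrow> nat \<Rightarrow> nat \<Rightarrow> real mat" where
  "hswme_block u v \<alpha> \<beta> i j =
    (if i = 0 \<and> j = 0 then mat2 (2 * u) 0 v u
     else if i = j then mat2 u 0 0 u
     else if j = i + 1 then
       mat2 ((real i + 2) / (2 * real i + 3) * \<alpha>) 0
            (1 / (2 * real i + 3) * \<beta>) ((real i + 1) / (2 * real i + 3) * \<alpha>)
     else if i = 1 \<and> j = 0 then mat2 (2 * \<alpha>) 0 \<beta> \<alpha>
     else if i = j + 1 then
       mat2 ((real i - 1) / (2 * real i - 1) * \<alpha>) 0
            (- (1 / (2 * real i - 1)) * \<beta>) (real i / (2 * real i - 1) * \<alpha>)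
     else 0\<^sub>m 2 2)"

definition hswme_col :: "real \<Rightarrow> real \<Rightarrow> real \<Rightarrow> real \<Rightarrow> real \<Rightarrow> real \<Rightarrow> nat \<Rightarrow> real vec" where
  "hswme_col g h u v \<alpha> \<beta> i =
    (if i = 0 then vec_of_list [- u\<^sup>2 - \<alpha>\<^sup>2 / 3 + g * h, - u * v - \<alpha> * \<beta> / 3]
     else if i = 1 then vec_of_list [- 2 * u * \<alpha>, - (u * \<beta> + v * \<alpha>)]
     else if i = 2 then vec_of_list [- (2 / 3) * \<alpha>\<^sup>2, - (2 / 3) * \<alpha> * \<beta>]
     else 0\<^sub>v 2)"

text \<open>Index \<open>0\<close> is the scalar row/column; index \<open>k \<ge> 1\<close> is component \<open>(k - 1) mod 2\<close> of block
  \<open>(k - 1) div 2\<close>. The arguments \<open>u v \<alpha> \<beta>\<close> stand for \<open>u\<^sub>m v\<^sub>m \<alpha>\<^sub>1 \<beta>\<^sub>1\<close>.\<close>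

definition hswme_matrix ::
  "nat \<Rightarrow> real \<Rightarrow> real \<Rightarrow> real \<Rightarrow> real \<Rightarrow> real \<Rightarrow> real \<Rightarrow> real mat" where
  "hswme_matrix N g h u v \<alpha> \<beta> = mat (2 * N + 3) (2 * N + 3) (\<lambda>(r, c).
     if r = 0 then (if c = 1 then 1 else 0)
     else if c = 0 then vec_index (hswme_col g h u v \<alpha> \<beta> ((r - 1) div 2)) ((r - 1) mod 2)
     else hswme_block u v \<alpha> \<beta> ((r - 1) div 2) ((c - 1) div 2) $$ ((r - 1) mod 2, (c - 1) mod 2))"

definition diagonalizable :: "'a :: semiring_1 mat \<Rightarrow> bool" where
  "diagonalizable A \<longleftrightarrow> (\<exists>D. diagonal_mat D \<and> similar_mat A D)"

text \<open>\<open>odd_double_fact N\<close> is \<open>(2N + 1)!! = 1 \<cdot> 3 \<cdots> (2N + 1)\<close>.\<close>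

definition odd_double_fact :: "nat \<Rightarrow> nat" where
  "odd_double_fact N = (\<Prod>k=0..N. 2 * k + 1)"

end

theory Submission
  imports Defs
begin

text \<open>The equations for \<open>(h, hu, h\<alpha>\<^sub>i)\<close> do not involve \<open>(hv, h\<beta>\<^sub>i)\<close>. For \<open>\<lambda> = u + \<xi>\<alpha>\<close>, the eigenvector
  equations of the second group, written for \<open>F\<^sub>i = V\<^sub>i / (2i + 1)\<close>, are Bonnet's recursion, which
  stops exactly when \<open>P\<^sub>N\<^sub>+\<^sub>1(\<xi>) = 0\<close>. Those of the first group, after normalising the \<open>h\<close>-entry to 1
  and subtracting \<open>2\<alpha>\<close> from \<open>U\<^sub>1\<close>, are solved by \<open>\<kappa> (2i + 1) / (i (i + 1)) P\<^sub>i'(\<xi>)\<close> with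
  \<open>\<kappa>\<alpha> = (\<xi>\<alpha>)\<^sup>2 - gh - \<alpha>\<^sup>2\<close>, so they stop when \<open>\<kappa> P\<^sub>N\<^sub>+\<^sub>1'(\<xi>) = 0\<close>; the second group is then a forced
  Bonnet recursion, solvable because \<open>P\<^sub>N\<^sub>+\<^sub>1(\<xi>) \<noteq> 0\<close>. The roots of \<open>P\<^sub>N\<^sub>+\<^sub>1\<close> and \<open>P\<^sub>N\<^sub>+\<^sub>1'\<close> are simple, disjoint
  and lie in \<open>(-1, 1)\<close>, whereas \<open>\<kappa> = 0\<close> forces \<open>\<bar>\<xi>\<bar> > 1\<close>. Hence there are \<open>2N + 3\<close> distinct eigenvalues.\<close>

section \<open>Roots of Legendre polynomials\<close>

lemma prod_linear_factors_dvd: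
  fixes p :: "'a :: idom poly"
  assumes "finite S" and "\<And>s. s \<in> S \<Longrightarrow> poly p s = 0"
  shows "(\<Prod>s\<in>S. [:- s, 1:]) dvd p"
  using assms
proof (induction S rule: finite_induct)
  case (insert x S)
  then obtain r where r: "p = (\<Prod>s\<in>S. [:- s, 1:]) * r" by (auto elim: dvdE)
  have "poly (\<Prod>s\<in>S. [:- s, 1:]) x \<noteq> 0"
    using insert.hyps by (auto simp: poly_prod)
  then have "[:- x, 1:] dvd r"
    using insert.prems[of x] r by (simp add: poly_eq_0_iff_dvd[symmetric])
  then show ?case
    using insert.hyps r by (simp del: mult_pCons_left add: mult.commute mult_dvd_mono)
qed simp

lemma degree_prod_linear_factors:
  "degree (\<Prod>s\<in>S. [:- s, 1 :: 'a :: idom:]) = card S"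
  by (cases "finite S") (simp_all add: degree_prod_eq_sum_degree)

lemma lead_coeff_prod_linear_factors:
  "lead_coeff (\<Prod>s\<in>S. [:- s, 1 :: 'a :: idom:]) = 1"
  by (simp add: lead_coeff_prod)

text \<open>Once the factors of the known roots are split off, the degree leaves only a constant
  cofactor, and the product is monic. Serves \<open>bonnet\<close>, its derivative and the
  characteristic polynomial alike.\<close>

lemma poly_eq_smult_prod_roots:
  fixes p :: "'a :: idom poly"
  assumes "finite S" and "p \<noteq> 0" and "degree p = card S"
    and "\<And>s. s \<in> S \<Longrightarrow> poly p s = 0"
  shows "p = smult (lead_coeff p) (\<Prod>s\<in>S. [:- s, 1:])"
proof -
  let ?q = "\<Prod>s\<in>S. [:- s, 1:]"
  obtain r where r: "p = ?q * r"
    using prod_linear_factors_dvd[of S p] assms by (auto elim: dvdE)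
  have "?q \<noteq> 0" "r \<noteq> 0" using r assms(2) by auto
  then have "degree r = 0"
    using r assms(3) degree_mult_eq[of ?q r] degree_prod_linear_factors[of S] by simp
  then obtain c where c: "r = [:c:]" by (auto elim: degree_eq_zeroE)
  have "lead_coeff p = c"
    unfolding r c lead_coeff_mult lead_coeff_prod_linear_factors by simp
  moreover have "p = smult c ?q" unfolding r c by simp
  ultimately show ?thesis by (simp only:)
qed

section \<open>Roots of polynomials orthogonal for a positive weight\<close>

lemma ex_pderiv_eq:
  fixes q :: "real poly"
  shows "\<exists>Q. pderiv Q = q \<and> degree Q \<le> Suc (degree q)"
proof (intro exI conjI)
  let ?Q = "\<Sum>i\<le>degree q. monom (coeff q i / real (Suc i)) (Suc i)"
  have "pderiv ?Q = (\<Sum>i\<le>degree q. monom (coeff q i) i)"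
    by (simp add: higher_pderiv_sum[of 1, simplified] pderiv_monom del: of_nat_Suc)
  then show "pderiv ?Q = q" by (simp add: poly_as_sum_of_monoms)
  show "degree ?Q \<le> Suc (degree q)"
    by (intro degree_sum_le) (auto intro: order.trans[OF degree_monom_le])
qed

text \<open>By the intermediate value theorem there is no sign change. The scalar \<sigma>, chosen
  as 1 or -1, lets both signs be treated as nonnegativity.\<close>

lemma poly_same_sign:
  fixes r :: "real poly"
  assumes "\<And>x. x \<in> {a<..<b} \<Longrightarrow> poly r x \<noteq> 0"
  shows "\<exists>\<sigma>. \<sigma> \<noteq> 0 \<and> (\<forall>x\<in>{a<..<b}. 0 \<le> \<sigma> * poly r x)"
proof (cases "\<forall>x\<in>{a<..<b}. 0 \<le> poly r x")
  case True
  then show ?thesis by (intro exI[of _ 1]) auto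
next
  case False
  then obtain y where y: "y \<in> {a<..<b}" "poly r y < 0" by force
  have "poly r x \<le> 0" if x: "x \<in> {a<..<b}" for x
  proof (rule ccontr)
    assume "\<not> poly r x \<le> 0"
    moreover have "x < y \<or> y < x" using y(2) calculation by (metis less_imp_le linorder_neqE)
    ultimately obtain z where "min x y < z" "z < max x y" "poly r z = 0"
      using poly_IVT_pos[of y x r] poly_IVT_neg[of x y r] y(2) by fastforce
    then have "z \<in> {a<..<b}" "poly r z = 0" using x y(1) by auto
    then show False using assms by blast
  qed
  then show ?thesis by (intro exI[of _ "-1"]) auto
qed

text \<open>If \<open>p\<close> had too few roots in \<open>(-1,1)\<close>, then the product \<open>q\<close> of the corresponding linear
  factors would be an admissible test polynomial for which \<open>w * p * q\<close> has constant sign.\<close>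

lemma orthogonal_poly_roots:
  fixes p w :: "real poly"
  assumes p: "p \<noteq> 0" and simple: "\<And>x. poly p x = 0 \<Longrightarrow> poly (pderiv p) x \<noteq> 0"
    and w: "\<And>x. x \<in> {-1<..<1} \<Longrightarrow> poly w x > 0"
    and orth: "\<And>q. degree q < degree p \<Longrightarrow> integral {-1..1} (\<lambda>x. poly (w * p * q) x) = 0"
  shows "card {x. poly p x = 0} = degree p" and "{x. poly p x = 0} \<subseteq> {-1<..<1}"
proof -
  define S where "S = {x. poly p x = 0} \<inter> {-1<..<1}"
  have fin: "finite {x. poly p x = 0}" by (rule poly_roots_finite[OF p])
  then have S: "finite S" by (simp add: S_def)
  let ?q = "\<Prod>s\<in>S. [:- s, 1:]"
  obtain r where r: "p = ?q * r"
    using prod_linear_factors_dvd[OF S, of p] by (auto simp: S_def elim: dvdE)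
  have q0: "?q \<noteq> 0" using r p by auto
  have le: "card S \<le> card {x. poly p x = 0}"
    by (intro card_mono fin) (auto simp: S_def)
  have le': "card {x. poly p x = 0} \<le> degree p"
    by (rule card_poly_roots_bound[OF p])
  have "card S = degree p"
  proof (rule ccontr)
    assume "card S \<noteq> degree p"
    then have "degree ?q < degree p"
      using le le' by (simp only: degree_prod_linear_factors)
    then have int0: "integral {-1..1} (\<lambda>x. poly (w * p * ?q) x) = 0" by (rule orth)
    \<comment> \<open>Every root in (-1,1) is already in \<open>S\<close>; if the cofactor vanished
      there too, the root would be double, against \<open>simple\<close>.\<close>
    have "poly r x \<noteq> 0" if "x \<in> {-1<..<1}" for x
    proof
      assume rx: "poly r x = 0"
      then have px: "poly p x = 0" by (simp add: r)
      then have "x \<in> S" using that by (simp add: S_def)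
      then have "poly ?q x = 0" using S by (auto simp: poly_prod)
      then have "poly (pderiv p) x = 0"
        using rx by (simp add: r pderiv_mult)
      then show False using simple px by blast
    qed
    then obtain \<sigma> where \<sigma>: "\<sigma> \<noteq> 0" "\<And>x. x \<in> {-1<..<1} \<Longrightarrow> 0 \<le> \<sigma> * poly r x"
      using poly_same_sign[of "-1" 1 r] by blast
    define f where "f = smult \<sigma> (w * p * ?q)"
    have f: "poly f x = poly w x * (poly ?q x)\<^sup>2 * (\<sigma> * poly r x)" for x
      by (simp add: f_def r power2_eq_square)
    have nonneg: "0 \<le> poly f x" if "x \<in> {-1<..<1}" for x
      unfolding f using w[OF that] \<sigma>(2)[OF that] by simp
    \<comment> \<open>Positivity of \<open>w\<close> is assumed on the open interval only, because 1
      - x^2 vanishes at the ends; continuity carries nonnegativity to the endpoints.\<close>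
    have nonneg': "0 \<le> poly f x" if "x \<in> {-1..1}" for x
      proof (rule continuous_ge_on_closure[where f = "poly f" and S = "{-1<..<1}"])
      show "continuous_on (closure {-1<..<1}) (poly f)" by (intro continuous_intros)
      show "x \<in> closure {-1<..<1}" using that by simp
    qed (use nonneg in auto)
    have intf: "((\<lambda>x. poly f x) has_integral 0) (cbox (-1) 1)"
      using has_integral_mult_right[OF integrable_integral[OF integrable_poly[of "w * p * ?q"]], of \<sigma>]
      by (simp add: int0 f_def del: poly_mult)
    have "poly f x = 0" if "x \<in> {-1..1}" for x
      by (rule has_integral_0_cbox_imp_0[OF _ _ intf])
        (use that nonneg' in \<open>auto intro!: continuous_intros\<close>)
    then have "{-1..1} \<subseteq> {x. poly f x = 0}" by auto
    moreover have "w \<noteq> 0" using w[of 0] by auto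
    then have "f \<noteq> 0" using p q0 \<sigma> by (simp add: f_def)
    ultimately have "finite {-1..1::real}"
      using poly_roots_finite finite_subset by blast
    then show False using infinite_Icc[of "-1::real" 1] by simp
  qed
  then have "card {x. poly p x = 0} = card S" using le le' by simp
  then have "S = {x. poly p x = 0}"
    by (intro card_subset_eq fin) (auto simp: S_def)
  then show "card {x. poly p x = 0} = degree p" "{x. poly p x = 0} \<subseteq> {-1<..<1}"
    using \<open>card S = degree p\<close> by (auto simp: S_def)
qed

section \<open>Roots of \<open>bonnet n\<close> and of its derivative\<close>

text \<open>Descent: by \<open>bonnet_deriv\<close>, a common root of \<open>bonnet (Suc n)\<close>
  and its derivative is also one of \<open>bonnet n\<close> and its derivative, which ends at the
  constant 1.\<close>

lemma bonnet_simple_roots: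
  "poly (bonnet n) x = 0 \<Longrightarrow> poly (pderiv (bonnet n)) x \<noteq> 0"
proof (induction n)
  case (Suc n)
  show ?case
  proof
    assume "poly (pderiv (bonnet (Suc n))) x = 0"
    then have "poly (pderiv (bonnet n)) x = 0" "poly (bonnet n) x = 0"
      using bonnet_deriv[of n x] Suc.prems by (auto simp: add_eq_0_iff)
    then show False using Suc.IH by blast
  qed
qed simp

text \<open>At a common root of the first and second derivative, Legendre's equation forces
  \<open>bonnet n\<close> to vanish too, so it would have a double root.\<close>

lemma pderiv_bonnet_simple_roots:
  assumes "n \<ge> 1" and "poly (pderiv (bonnet n)) x = 0"
  shows "poly (pderiv (pderiv (bonnet n))) x \<noteq> 0"
proof
  assume "poly (pderiv (pderiv (bonnet n))) x = 0"
  then have "real n * (real n + 1) * poly (bonnet n) x = 0"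
    using arg_cong[OF bonnet_ode[of n], of "\<lambda>p. poly p x"] assms
    by (simp add: pderiv_mult del: mult_pCons_left)
  then have "poly (bonnet n) x = 0" using assms(1) by (auto simp: add_eq_0_iff)
  then show False using bonnet_simple_roots assms(2) by blast
qed

text \<open>Integration by parts: \<open>bonnet_ode\<close> turns the derivative of weight times
  \<open>pderiv (bonnet n)\<close> into a multiple of \<open>bonnet n\<close>, which is orthogonal
  to the antiderivative of \<open>q\<close>.\<close>

lemma pderiv_bonnet_orthogonal:
  assumes "Suc (degree q) < n"
  shows "integral {-1..1} (\<lambda>x. poly ([:1, 0, -1:] * pderiv (bonnet n) * q) x) = 0"
proof -
  let ?w = "[:-1, 0, 1:] :: real poly"
  obtain Q where Q: "pderiv Q = q" "degree Q \<le> Suc (degree q)" using ex_pderiv_eq by blast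
  have "integral {-1..1} (\<lambda>x. poly (bonnet n * Q) x) = 0"
    using Q assms bonnet_orthogonal_lower[of n n Q] by (simp add: coeff_eq_0)
  \<comment> \<open>The boundary terms vanish because the weight is zero at -1 and 1.\<close>
  moreover have "integral {-1..1} (\<lambda>x. poly (pderiv (?w * pderiv (bonnet n) * Q)) x) = 0"
    using integral_pderiv[of "?w * pderiv (bonnet n) * Q"] by simp
  moreover have "(\<lambda>x. poly ([:1, 0, -1:] * pderiv (bonnet n) * q) x) =
      (\<lambda>x. real n * (real n + 1) * poly (bonnet n * Q) x
        - poly (pderiv (?w * pderiv (bonnet n) * Q)) x)"
    unfolding pderiv_mult[of "?w * pderiv (bonnet n)"] bonnet_ode Q
    by (auto simp: algebra_simps)
  ultimately show ?thesis
    by (simp add: integral_diff integrable_poly integrable_on_mult_right del: poly_mult)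
qed

lemma bonnet_roots:
  shows "card {x. poly (bonnet n) x = 0} = n" and "{x. poly (bonnet n) x = 0} \<subseteq> {-1<..<1}"
proof -
  have "bonnet n \<noteq> 0" using bonnet_at_1[of n] by auto
  moreover have "integral {-1..1} (\<lambda>x. poly (1 * bonnet n * q) x) = 0"
    if "degree q < degree (bonnet n)" for q
    using that bonnet_orthogonal_lower[of n n q] by (simp add: coeff_eq_0 degree_bonnet)
  ultimately show "card {x. poly (bonnet n) x = 0} = n" "{x. poly (bonnet n) x = 0} \<subseteq> {-1<..<1}"
    using orthogonal_poly_roots[of "bonnet n" 1] bonnet_simple_roots by (auto simp: degree_bonnet)
qed

lemma degree_pderiv_bonnet: "degree (pderiv (bonnet (Suc n))) = n"
  by (simp add: degree_pderiv degree_bonnet del: bonnet.simps)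

lemma pderiv_bonnet_neq_0: "pderiv (bonnet (Suc n)) \<noteq> 0"
  using degree_bonnet[of "Suc n"] by (simp add: pderiv_eq_0_iff del: bonnet.simps)

lemma pderiv_bonnet_roots:
  shows "card {x. poly (pderiv (bonnet (Suc n))) x = 0} = n"
    and "{x. poly (pderiv (bonnet (Suc n))) x = 0} \<subseteq> {-1<..<1}"
proof -
  have w: "poly [:1, 0, -1:] x > 0" if "x \<in> {-1<..<1}" for x :: real
  proof -
    have "(1 - x) * (1 + x) > 0" using that by (intro mult_pos_pos) auto
    then show ?thesis by (simp add: algebra_simps)
  qed
  have simple: "poly (pderiv (pderiv (bonnet (Suc n)))) x \<noteq> 0"
    if "poly (pderiv (bonnet (Suc n))) x = 0" for x
    using that by (rule pderiv_bonnet_simple_roots[rotated]) simp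
  have "integral {-1..1} (\<lambda>x. poly ([:1, 0, -1:] * pderiv (bonnet (Suc n)) * q) x) = 0"
    if "degree q < degree (pderiv (bonnet (Suc n)))" for q
    using that by (intro pderiv_bonnet_orthogonal) (simp only: degree_pderiv_bonnet Suc_less_eq)
  note orthogonal_poly_roots[OF pderiv_bonnet_neq_0 simple w this]
  then show "card {x. poly (pderiv (bonnet (Suc n))) x = 0} = n"
    "{x. poly (pderiv (bonnet (Suc n))) x = 0} \<subseteq> {-1<..<1}"
    unfolding degree_pderiv_bonnet by blast+
qed

section \<open>Leading coefficients and further recursions\<close>

text \<open>Only \<open>[:0, 1:] * bonnet (Suc n)\<close> reaches the top degree in Bonnet's
  recursion, so each step multiplies by (2n + 3)/(n + 2). This yields the constant of the
  characteristic polynomial.\<close>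

lemma lead_coeff_bonnet:
  "coeff (bonnet (Suc n)) (Suc n) = real (odd_double_fact n) / fact (Suc n)"
proof (induction n)
  case (Suc n)
  have "coeff (bonnet n) (Suc (Suc n)) = 0" using bonnet_coeffs[of n] by simp
  then have "coeff (bonnet (Suc (Suc n))) (Suc (Suc n))
      = (2 * real n + 3) / (real n + 2) * coeff (bonnet (Suc n)) (Suc n)"
    by simp
  then have "coeff (bonnet (Suc (Suc n))) (Suc (Suc n))
      = (2 * real n + 3) / (real n + 2) * (real (odd_double_fact n) / fact (Suc n))"
    unfolding Suc .
  also have "\<dots> = ((2 * real n + 3) * real (odd_double_fact n)) / ((real n + 2) * fact (Suc n))"
    by simp
  also have "(2 * real n + 3) * real (odd_double_fact n) = real (odd_double_fact (Suc n))"
    by (simp add: odd_double_fact_def algebra_simps)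
  also have "(real n + 2) * fact (Suc n) = fact (Suc (Suc n))"
    by (simp add: algebra_simps)
  finally show ?case .
qed (simp add: odd_double_fact_def)

lemma lead_coeff_pderiv_bonnet:
  "coeff (pderiv (bonnet (Suc n))) n = real (odd_double_fact n) / fact n"
  unfolding coeff_pderiv lead_coeff_bonnet fact_Suc by (simp del: of_nat_Suc)

text \<open>Both neighbouring derivatives are expressed through index \<open>Suc n\<close>; the
  weights n + 1 and n + 2 then cancel \<open>bonnet (Suc n)\<close>. This recursion governs the
  first group of eigenvector equations.\<close>

lemma pderiv_bonnet_rec:
  "(2 * real n + 3) * x * poly (pderiv (bonnet (Suc n))) x =
    (real n + 1) * poly (pderiv (bonnet (Suc (Suc n)))) x
      + (real n + 2) * poly (pderiv (bonnet n)) x"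
proof -
  have 1: "poly (pderiv (bonnet n)) x
      = x * poly (pderiv (bonnet (Suc n))) x - (real n + 1) * poly (bonnet (Suc n)) x"
    using bonnet_deriv[of n x] by linarith
  have 2: "poly (pderiv (bonnet (Suc (Suc n)))) x
      = x * poly (pderiv (bonnet (Suc n))) x + (real n + 2) * poly (bonnet (Suc n)) x"
    using bonnet_deriv[of "Suc n" x] by (simp del: bonnet.simps)
  show ?thesis unfolding 2 1 by (simp add: algebra_simps del: bonnet.simps)
qed

text \<open>Particular solution of the forced recursion started at 0; the value at 1 is what the
  recursion demands at index 0.\<close>

fun bonnet_forced :: "(nat \<Rightarrow> real) \<Rightarrow> real \<Rightarrow> nat \<Rightarrow> real" where
  "bonnet_forced \<sigma> \<xi> 0 = 0"
| "bonnet_forced \<sigma> \<xi> (Suc 0) = - \<sigma> 0"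
| "bonnet_forced \<sigma> \<xi> (Suc (Suc n)) =
    ((2 * real n + 3) * \<xi> * bonnet_forced \<sigma> \<xi> (Suc n)
      - (real n + 1) * bonnet_forced \<sigma> \<xi> n - \<sigma> (Suc n)) / (real n + 2)"

text \<open>Superposition: a multiple of the homogeneous solution \<open>bonnet\<close> corrects the
  end value to 0 without disturbing the recursion. At \<open>i = 0\<close> the term
  \<open>F (i - 1)\<close> has coefficient 0.\<close>

lemma inhomogeneous_bonnet_solvable:
  assumes "poly (bonnet (Suc N)) \<xi> \<noteq> 0"
  shows "\<exists>F. F (Suc N) = 0 \<and>
    (\<forall>i. (real i + 1) * F (Suc i) + real i * F (i - 1) = (2 * real i + 1) * \<xi> * F i - \<sigma> i)"
proof -
  define c where "c = - bonnet_forced \<sigma> \<xi> (Suc N) / poly (bonnet (Suc N)) \<xi>"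
  define F where "F i = bonnet_forced \<sigma> \<xi> i + c * poly (bonnet i) \<xi>" for i
  have "F (Suc N) = 0" using assms by (simp add: F_def c_def del: bonnet.simps bonnet_forced.simps)
  moreover have "(real i + 1) * F (Suc i) + real i * F (i - 1) = (2 * real i + 1) * \<xi> * F i - \<sigma> i" for i
  proof (cases i)
    case (Suc n)
    have "(real n + 2) * bonnet_forced \<sigma> \<xi> (Suc (Suc n)) =
      (2 * real n + 3) * \<xi> * bonnet_forced \<sigma> \<xi> (Suc n)
        - (real n + 1) * bonnet_forced \<sigma> \<xi> n - \<sigma> (Suc n)"
      by (simp add: add_eq_0_iff)
    moreover have "c * ((real n + 2) * poly (bonnet (Suc (Suc n))) \<xi>) =
        c * ((2 * real n + 3) * \<xi> * poly (bonnet (Suc n)) \<xi> - (real n + 1) * poly (bonnet n) \<xi>)"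
      unfolding poly_bonnet_rec ..
    ultimately show ?thesis
      unfolding Suc F_def by (simp add: algebra_simps del: bonnet.simps bonnet_forced.simps)
  qed (simp add: F_def)
  ultimately show ?thesis by blast
qed

section \<open>Eigenvectors of the HSWME matrix\<close>

lemma sum_odd_even_split:
  fixes f :: "nat \<Rightarrow> 'a :: comm_monoid_add"
  shows "(\<Sum>c<2 * n + 1. f c) = f 0 + (\<Sum>j<n. f (2 * j + 1) + f (2 * j + 2))"
  by (induction n) (simp_all add: ac_simps)

lemma sum_tridiagonal:
  fixes t :: "nat \<Rightarrow> 'a :: comm_monoid_add"
  assumes "i < n" and "t n = 0" and "\<And>j. j + 1 < i \<or> i + 1 < j \<Longrightarrow> t j = 0"
  shows "(\<Sum>j<n. t j) = (if i = 0 then 0 else t (i - 1)) + t i + t (i + 1)"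
proof -
  have "(\<Sum>j<n. t j) = (\<Sum>j<Suc n. t j)" using assms(2) by simp
  \<comment> \<open>For \<open>i = 0\<close> truncated subtraction merges \<open>i - 1\<close> with
    \<open>i\<close>, hence the case distinction in the result.\<close>
  also have "\<dots> = (\<Sum>j\<in>{i - 1, i, i + 1}. t j)"
  proof (intro sum.mono_neutral_right ballI)
    fix j assume "j \<in> {..<Suc n} - {i - 1, i, i + 1}"
    then have "j + 1 < i \<or> i + 1 < j" by auto
    then show "t j = 0" by (rule assms(3))
  qed (use assms(1) in auto)
  also have "\<dots> = (if i = 0 then 0 else t (i - 1)) + t i + t (i + 1)"
    by (cases i) (auto simp: add.assoc)
  finally show ?thesis .
qed

lemma mat2_index:
  "mat2 a b c d $$ (0, 0) = a" "mat2 a b c d $$ (0, Suc 0) = b"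
  "mat2 a b c d $$ (Suc 0, 0) = c" "mat2 a b c d $$ (Suc 0, Suc 0) = d"
  by (simp_all add: mat_of_rows_list_def)

text \<open>\<open>X\<close> is the entry for h, \<open>U\<close> collects the first block
  components and \<open>V\<close> the second. The two groups are thus separate sequences while the
  vector keeps the interleaved order of the matrix.\<close>

definition hswme_vec :: "nat \<Rightarrow> real \<Rightarrow> (nat \<Rightarrow> real) \<Rightarrow> (nat \<Rightarrow> real) \<Rightarrow> real vec" where
  "hswme_vec N X U V = vec (2 * N + 3)
    (\<lambda>k. if k = 0 then X else if odd k then U ((k - 1) div 2) else V ((k - 1) div 2))"

lemma hswme_vec_index:
  "vec_index (hswme_vec N X U V) 0 = X"
  "i \<le> N \<Longrightarrow> vec_index (hswme_vec N X U V) (2 * i + 1) = U i"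
  "i \<le> N \<Longrightarrow> vec_index (hswme_vec N X U V) (2 * i + 2) = V i"
  by (auto simp: hswme_vec_def)

lemma hswme_mult_vec_0:
  assumes "N \<ge> 1"
  shows "vec_index (hswme_matrix N g h u v \<alpha> \<beta> *\<^sub>v hswme_vec N X U V) 0 = U 0"
proof -
  have "vec_index (hswme_matrix N g h u v \<alpha> \<beta> *\<^sub>v hswme_vec N X U V) 0
      = (\<Sum>c<2 * N + 3. (if c = 1 then 1 else 0) * vec_index (hswme_vec N X U V) c)"
    by (auto simp: hswme_matrix_def hswme_vec_def scalar_prod_def atLeast0LessThan intro!: sum.cong)
  also have "\<dots> = (\<Sum>c<2 * N + 3. if c = 1 then vec_index (hswme_vec N X U V) 1 else 0)"
    by (intro sum.cong) auto
  also have "\<dots> = U 0" using hswme_vec_index(2)[of 0 N X U V] by (simp add: sum.delta)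
  finally show ?thesis .
qed

lemma hswme_mult_vec_block:
  assumes "i \<le> N" and "e < 2"
  shows "vec_index (hswme_matrix N g h u v \<alpha> \<beta> *\<^sub>v hswme_vec N X U V) (2 * i + 1 + e)
    = vec_index (hswme_col g h u v \<alpha> \<beta> i) e * X
      + (\<Sum>j<N + 1. hswme_block u v \<alpha> \<beta> i j $$ (e, 0) * U j + hswme_block u v \<alpha> \<beta> i j $$ (e, 1) * V j)"
proof -
  let ?x = "hswme_vec N X U V"
  let ?B = "hswme_block u v \<alpha> \<beta> i"
  have e: "(2 * i + e) div 2 = i" "(2 * i + e) mod 2 = e" using assms(2) by auto
  have "vec_index (hswme_matrix N g h u v \<alpha> \<beta> *\<^sub>v ?x) (2 * i + 1 + e)
      = (\<Sum>c<2 * N + 3. (if c = 0 then vec_index (hswme_col g h u v \<alpha> \<beta> i) e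
          else ?B ((c - 1) div 2) $$ (e, (c - 1) mod 2)) * vec_index ?x c)"
    using assms e
    by (simp add: hswme_matrix_def hswme_vec_def scalar_prod_def atLeast0LessThan cong: if_cong)
  also have "2 * N + 3 = 2 * (N + 1) + 1" by simp
  also have "(\<Sum>c<2 * (N + 1) + 1. (if c = 0 then vec_index (hswme_col g h u v \<alpha> \<beta> i) e
          else ?B ((c - 1) div 2) $$ (e, (c - 1) mod 2)) * vec_index ?x c)
    = vec_index (hswme_col g h u v \<alpha> \<beta> i) e * X
      + (\<Sum>j<N + 1. ?B j $$ (e, 0) * U j + ?B j $$ (e, 1) * V j)"
    unfolding sum_odd_even_split
    by (intro arg_cong2[of _ _ _ _ "(+)"] sum.cong)
      (auto simp: hswme_vec_index hswme_vec_index[simplified])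
  finally show ?thesis .
qed

text \<open>\<open>V\<close> drops out because every block has a zero upper right entry.
  \<open>U (N + 1) = 0\<close> stands for the omitted block beyond \<open>N\<close>.\<close>

lemma hswme_mult_vec_odd:
  assumes "i \<le> N" and "U (N + 1) = 0"
  shows "vec_index (hswme_matrix N g h u v \<alpha> \<beta> *\<^sub>v hswme_vec N X U V) (2 * i + 1) =
    (if i = 0 then (- u\<^sup>2 - \<alpha>\<^sup>2 / 3 + g * h) * X + 2 * u * U 0
     else if i = 1 then - 2 * u * \<alpha> * X + 2 * \<alpha> * U 0 + u * U 1
     else (if i = 2 then - (2 / 3) * \<alpha>\<^sup>2 * X else 0)
       + (real i - 1) / (2 * real i - 1) * \<alpha> * U (i - 1) + u * U i)
    + (real i + 2) / (2 * real i + 3) * \<alpha> * U (i + 1)"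
proof -
  let ?t = "\<lambda>j. hswme_block u v \<alpha> \<beta> i j $$ (0, 0) * U j"
  have "vec_index (hswme_matrix N g h u v \<alpha> \<beta> *\<^sub>v hswme_vec N X U V) (2 * i + 1)
      = vec_index (hswme_col g h u v \<alpha> \<beta> i) 0 * X + (\<Sum>j<N + 1. ?t j)"
    using hswme_mult_vec_block[OF assms(1), of 0 g h u v \<alpha> \<beta> X U V]
    by (simp add: hswme_block_def mat2_index if_distrib[of "\<lambda>M. M $$ _"] cong: if_cong)
  also have "(\<Sum>j<N + 1. ?t j) = (if i = 0 then 0 else ?t (i - 1)) + ?t i + ?t (i + 1)"
    using assms by (intro sum_tridiagonal) (auto simp: hswme_block_def)
  finally show ?thesis
    by (auto simp: hswme_block_def hswme_col_def mat2_index of_nat_diff)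
qed

text \<open>What the scalar column and the first group contribute to row \<open>2 * i + 2\<close>;
  it acts as forcing on the second group.\<close>

definition hswme_coupling ::
  "real \<Rightarrow> real \<Rightarrow> real \<Rightarrow> real \<Rightarrow> real \<Rightarrow> (nat \<Rightarrow> real) \<Rightarrow> nat \<Rightarrow> real" where
  "hswme_coupling u v \<alpha> \<beta> X U i =
    (if i = 0 then (- u * v - \<alpha> * \<beta> / 3) * X + v * U 0
     else if i = 1 then - (u * \<beta> + v * \<alpha>) * X + \<beta> * U 0
     else (if i = 2 then - (2 / 3) * \<alpha> * \<beta> * X else 0) - \<beta> / (2 * real i - 1) * U (i - 1))
    + \<beta> / (2 * real i + 3) * U (i + 1)"

lemma hswme_coupling_0: "hswme_coupling u v \<alpha> \<beta> 0 (\<lambda>_. 0) i = 0"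
  by (simp add: hswme_coupling_def)

text \<open>Scaling the second group by 2i + 1 cancels the denominators 2i - 1 and 2i + 3 and leaves
  Bonnet's coefficients.\<close>

lemma hswme_mult_vec_even:
  assumes "i \<le> N" and "U (N + 1) = 0" and "F (N + 1) = 0"
  shows "vec_index (hswme_matrix N g h u v \<alpha> \<beta>
      *\<^sub>v hswme_vec N X U (\<lambda>i. (2 * real i + 1) * F i)) (2 * i + 2) =
    hswme_coupling u v \<alpha> \<beta> X U i
      + \<alpha> * ((real i + 1) * F (i + 1) + real i * F (i - 1)) + u * ((2 * real i + 1) * F i)"
proof -
  let ?V = "\<lambda>i. (2 * real i + 1) * F i"
  let ?t = "\<lambda>j. hswme_block u v \<alpha> \<beta> i j $$ (1, 0) * U j + hswme_block u v \<alpha> \<beta> i j $$ (1, 1) * ?V j"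
  have "vec_index (hswme_matrix N g h u v \<alpha> \<beta> *\<^sub>v hswme_vec N X U ?V) (2 * i + 2)
      = vec_index (hswme_col g h u v \<alpha> \<beta> i) 1 * X + (\<Sum>j<N + 1. ?t j)"
    using hswme_mult_vec_block[OF assms(1), of 1 g h u v \<alpha> \<beta> X U ?V] by simp
  also have "(\<Sum>j<N + 1. ?t j) = (if i = 0 then 0 else ?t (i - 1)) + ?t i + ?t (i + 1)"
    using assms by (intro sum_tridiagonal) (auto simp: hswme_block_def)
  \<comment> \<open>The exceptional blocks E_00 and E_10 have the same lower right entries as the
    general formulas, so only the coupling needs cases.\<close>
  also have "vec_index (hswme_col g h u v \<alpha> \<beta> i) 1 * X
      + ((if i = 0 then 0 else ?t (i - 1)) + ?t i + ?t (i + 1))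
    = hswme_coupling u v \<alpha> \<beta> X U i
      + (real i / (2 * real i - 1) * \<alpha> * ?V (i - 1) + u * ?V i
        + (real i + 1) / (2 * real i + 3) * \<alpha> * ?V (i + 1))"
    by (auto simp: hswme_block_def hswme_col_def hswme_coupling_def mat2_index of_nat_diff)
  also have "real i / (2 * real i - 1) * \<alpha> * ?V (i - 1) = \<alpha> * (real i * F (i - 1))"
  proof (cases i)
    case (Suc n)
    have "2 * real n + 1 \<noteq> 0" by linarith
    then show ?thesis by (simp add: Suc field_simps)
  qed simp
  also have "(real i + 1) / (2 * real i + 3) * \<alpha> * ?V (i + 1) = \<alpha> * ((real i + 1) * F (i + 1))"
  proof -
    have "2 * real i + 3 \<noteq> 0" by linarith
    then show ?thesis by (simp add: field_simps)
  qed
  finally show ?thesis by (simp add: algebra_simps)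
qed

section \<open>Eigenvectors from solutions of the recursions\<close>

lemma hswme_eigenvalueI:
  assumes N: "N \<ge> 1" and bd: "U (N + 1) = 0" "F (N + 1) = 0"
    and nz: "X \<noteq> 0 \<or> F 0 \<noteq> 0"
    and lam: "U 0 = l * X"
    and U: "\<And>i. i \<le> N \<Longrightarrow>
      (if i = 0 then (- u\<^sup>2 - \<alpha>\<^sup>2 / 3 + g * h) * X + 2 * u * U 0
       else if i = 1 then - 2 * u * \<alpha> * X + 2 * \<alpha> * U 0 + u * U 1
       else (if i = 2 then - (2 / 3) * \<alpha>\<^sup>2 * X else 0)
         + (real i - 1) / (2 * real i - 1) * \<alpha> * U (i - 1) + u * U i)
      + (real i + 2) / (2 * real i + 3) * \<alpha> * U (i + 1) = l * U i"
    and F: "\<And>i. i \<le> N \<Longrightarrow>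
      hswme_coupling u v \<alpha> \<beta> X U i + \<alpha> * ((real i + 1) * F (i + 1) + real i * F (i - 1))
        = (l - u) * ((2 * real i + 1) * F i)"
  shows "eigenvalue (hswme_matrix N g h u v \<alpha> \<beta>) l"
proof -
  define V where "V i = (2 * real i + 1) * F i" for i
  let ?A = "hswme_matrix N g h u v \<alpha> \<beta>" and ?x = "hswme_vec N X U V"
  have dim: "dim_row ?A = 2 * N + 3" by (simp add: hswme_matrix_def)
  have dimx: "dim_vec ?x = 2 * N + 3" by (simp add: hswme_vec_def)
  have "?x \<noteq> 0\<^sub>v (dim_row ?A)"
  proof
    assume "?x = 0\<^sub>v (dim_row ?A)"
    \<comment> \<open>Entry 0 is \<open>X\<close> and entry 2 is \<open>V 0 = F 0\<close>, the two
      values in \<open>nz\<close>.\<close>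
    then have "vec_index ?x 0 = 0" "vec_index ?x 2 = 0" by (simp_all add: dim)
    then show False
      using nz hswme_vec_index(1)[of N X U V] hswme_vec_index(3)[of 0 N X U V]
      by (simp add: V_def numeral_2_eq_2)
  qed
  moreover have "?A *\<^sub>v ?x = l \<cdot>\<^sub>v ?x"
  proof (rule eq_vecI)
    fix k assume "k < dim_vec (l \<cdot>\<^sub>v ?x)"
    then have k: "k < 2 * N + 3" by (simp add: dimx)
    consider "k = 0" | i where "k = 2 * i + 1" "i \<le> N" | i where "k = 2 * i + 2" "i \<le> N"
    proof -
      have "k = 0 \<or> k = 2 * ((k - 1) div 2) + 1 \<or> k = 2 * ((k - 1) div 2) + 2"
        "(k - 1) div 2 \<le> N"
        using k by presburger+
      then show thesis using that by blast
    qed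
    then show "vec_index (?A *\<^sub>v ?x) k = vec_index (l \<cdot>\<^sub>v ?x) k"
    proof cases
      case 1
      then show ?thesis
        using hswme_mult_vec_0[OF N, of g h u v \<alpha> \<beta> X U V] lam hswme_vec_index(1)[of N X U V] dimx
        by simp
    next
      case (2 i)
      have "vec_index (?A *\<^sub>v ?x) k = l * U i"
        unfolding 2(1) hswme_mult_vec_odd[where U = U, OF 2(2) bd(1)] by (rule U[OF 2(2)])
      then show ?thesis using k hswme_vec_index(2)[OF 2(2), of X U V] by (simp add: 2(1) dimx)
    next
      case (3 i)
      have "vec_index (?A *\<^sub>v ?x) k = l * V i"
        unfolding 3(1) V_def hswme_mult_vec_even[where U = U and F = F, OF 3(2) bd] F[OF 3(2)]
        by (simp add: algebra_simps)
      then show ?thesis using k hswme_vec_index(3)[OF 3(2), of X U V] by (simp add: 3(1) dimx)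
    qed
  qed (simp add: dim dimx)
  ultimately have "eigenvector ?A ?x l"
    using dim dimx unfolding eigenvector_def by (auto intro: carrier_vecI)
  then show ?thesis unfolding eigenvalue_def by blast
qed

text \<open>With the first group zero no forcing remains. The root supplies the end value, and
  \<open>F 0 = 1\<close> makes the vector nonzero.\<close>

lemma hswme_eigenvalue_bonnet_root:
  assumes N: "N \<ge> 1" and root: "poly (bonnet (N + 1)) \<xi> = 0"
  shows "eigenvalue (hswme_matrix N g h u v \<alpha> \<beta>) (u + \<xi> * \<alpha>)"
proof (rule hswme_eigenvalueI[OF N, where X = 0 and U = "\<lambda>_. 0" and F = "\<lambda>i. poly (bonnet i) \<xi>"])
  fix i
  have "(real i + 1) * poly (bonnet (i + 1)) \<xi> + real i * poly (bonnet (i - 1)) \<xi>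
      = (2 * real i + 1) * \<xi> * poly (bonnet i) \<xi>"
  proof (cases i)
    case (Suc n)
    then show ?thesis using poly_bonnet_rec[of n \<xi>] by (simp add: algebra_simps del: bonnet.simps)
  qed simp
  then show "hswme_coupling u v \<alpha> \<beta> 0 (\<lambda>_. 0) i
      + \<alpha> * ((real i + 1) * poly (bonnet (i + 1)) \<xi> + real i * poly (bonnet (i - 1)) \<xi>)
      = (u + \<xi> * \<alpha> - u) * ((2 * real i + 1) * poly (bonnet i) \<xi>)"
    by (simp add: hswme_coupling_0 del: bonnet.simps)
qed (use root in \<open>auto simp del: bonnet.simps(3)\<close>)

text \<open>Hypothesis \<open>zero\<close> unites the roots of the quadratic factor with those of
  the derivative: both make the same ansatz for \<open>U\<close> vanish at
  \<open>N + 1\<close>.\<close>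

lemma hswme_eigenvalue_nonroot:
  assumes N: "N \<ge> 1" and \<alpha>: "\<alpha> \<noteq> 0" and nonroot: "poly (bonnet (N + 1)) \<xi> \<noteq> 0"
    and zero: "((\<xi> * \<alpha>)\<^sup>2 - g * h - \<alpha>\<^sup>2) * poly (pderiv (bonnet (N + 1))) \<xi> = 0"
  shows "eigenvalue (hswme_matrix N g h u v \<alpha> \<beta>) (u + \<xi> * \<alpha>)"
proof -
  \<comment> \<open>This is the value for which block row 0 holds when \<open>z 1\<close> is 3/2
    \<kappa>.\<close>
  define \<kappa> where "\<kappa> = ((\<xi> * \<alpha>)\<^sup>2 - g * h - \<alpha>\<^sup>2) / \<alpha>"
  \<comment> \<open>The factor (2i + 1)/(i (i + 1)) turns \<open>pderiv_bonnet_rec\<close> into the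
    row recursion \<open>z_rec\<close>.\<close>
  define z where "z i = \<kappa> * (2 * real i + 1) / (real i * (real i + 1)) * poly (pderiv (bonnet i)) \<xi>" for i
  \<comment> \<open>The h-row with \<open>X = 1\<close> forces \<open>U 0\<close>; the shift by
    2\<alpha> absorbs the scalar column and the entry 2\<alpha> of E_10.\<close>
  define U where "U i = (if i = 0 then u + \<xi> * \<alpha> else if i = 1 then 2 * \<alpha> + z 1 else z i)" for i
  define \<sigma> where "\<sigma> i = hswme_coupling u v \<alpha> \<beta> 1 U i / \<alpha>" for i
  obtain F where F: "F (N + 1) = 0"
    "\<And>i. (real i + 1) * F (i + 1) + real i * F (i - 1) = (2 * real i + 1) * \<xi> * F i - \<sigma> i"
    using inhomogeneous_bonnet_solvable[of N \<xi> \<sigma>] nonroot by auto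
  have z1: "z (Suc 0) = 3 / 2 * \<kappa>" by (simp add: z_def pderiv_pCons)
  have z_rec: "(real i - 1) / (2 * real i - 1) * z (i - 1) + (real i + 2) / (2 * real i + 3) * z (i + 1)
      = \<xi> * z i" if i1: "i \<ge> 1" for i
  proof -
    obtain n where i: "i = Suc n" using i1 by (cases i) auto
    have nz: "2 * real n + 1 \<noteq> 0" "2 * real n + 3 \<noteq> 0" "2 * real n + 5 \<noteq> 0" "real n + 1 \<noteq> 0"
      "real n + 2 \<noteq> 0" "real n + 3 \<noteq> 0" by linarith+
    \<comment> \<open>For \<open>n = 0\<close> both sides are 0: the factor i - 1 vanishes and
      \<open>bonnet 0\<close> is constant.\<close>
    have "(real i - 1) / (2 * real i - 1) * z (i - 1) = \<kappa> / (real n + 1) * poly (pderiv (bonnet n)) \<xi>"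
      using nz by (cases "n = 0") (simp_all add: i z_def divide_simps)
    moreover have "(real i + 2) / (2 * real i + 3) * z (i + 1)
        = \<kappa> / (real n + 2) * poly (pderiv (bonnet (Suc (Suc n)))) \<xi>"
      using nz by (simp add: i z_def divide_simps add.commute del: bonnet.simps)
    moreover have "\<xi> * z i = \<kappa> / ((real n + 1) * (real n + 2))
        * ((2 * real n + 3) * \<xi> * poly (pderiv (bonnet (Suc n))) \<xi>)"
      using nz by (simp add: i z_def divide_simps add.commute del: bonnet.simps)
    moreover have "\<dots> = \<kappa> / (real n + 1) * poly (pderiv (bonnet n)) \<xi>
        + \<kappa> / (real n + 2) * poly (pderiv (bonnet (Suc (Suc n)))) \<xi>"
      unfolding pderiv_bonnet_rec using nz by (simp add: divide_simps del: bonnet.simps) (simp add: algebra_simps del: bonnet.simps)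
    ultimately show ?thesis by simp
  qed
  show ?thesis
  proof (rule hswme_eigenvalueI[OF N, where X = 1 and U = U and F = F])
    \<comment> \<open>As \<open>N + 1\<close> is at least 2, this is \<open>z (N + 1)\<close>, a
      multiple of the product in \<open>zero\<close>.\<close>
    show "U (N + 1) = 0" using zero N \<alpha> by (auto simp: U_def z_def \<kappa>_def)
    show "U 0 = (u + \<xi> * \<alpha>) * 1" by (simp add: U_def)
    fix i
    show "hswme_coupling u v \<alpha> \<beta> 1 U i + \<alpha> * ((real i + 1) * F (i + 1) + real i * F (i - 1))
        = (u + \<xi> * \<alpha> - u) * ((2 * real i + 1) * F i)"
      unfolding F(2) using \<alpha> by (simp add: \<sigma>_def algebra_simps)
    consider "i = 0" | "i = 1" | "i = 2" | "i \<ge> 3" by linarith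
    then show "(if i = 0 then (- u\<^sup>2 - \<alpha>\<^sup>2 / 3 + g * h) * 1 + 2 * u * U 0
       else if i = 1 then - 2 * u * \<alpha> * 1 + 2 * \<alpha> * U 0 + u * U 1
       else (if i = 2 then - (2 / 3) * \<alpha>\<^sup>2 * 1 else 0)
         + (real i - 1) / (2 * real i - 1) * \<alpha> * U (i - 1) + u * U i)
      + (real i + 2) / (2 * real i + 3) * \<alpha> * U (i + 1) = (u + \<xi> * \<alpha>) * U i"
    proof cases
      case 1
      have "\<kappa> * \<alpha> = (\<xi> * \<alpha>)\<^sup>2 - g * h - \<alpha>\<^sup>2" using \<alpha> by (simp add: \<kappa>_def)
      then show ?thesis using 1 by (simp add: U_def z1 power2_eq_square algebra_simps)
    next
      case 2
      then show ?thesis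
        using arg_cong[OF z_rec[of 1], of "\<lambda>t. \<alpha> * t"]
        by (simp add: U_def algebra_simps numeral_2_eq_2)
    next
      \<comment> \<open>The shift in \<open>U 1\<close> enters with coefficient \<alpha>/3 and
        cancels the term -2/3 \<alpha>^2.\<close>
      case 3
      then show ?thesis
        using arg_cong[OF z_rec[of 2], of "\<lambda>t. \<alpha> * t"]
        by (simp add: U_def algebra_simps power2_eq_square)
    next
      case 4
      \<comment> \<open>From here on no neighbour is the shifted \<open>U 1\<close>.\<close>
      then have "i - 1 \<noteq> 1" by linarith
      then show ?thesis
        using 4 arg_cong[OF z_rec[of i], of "\<lambda>t. \<alpha> * t"] by (simp add: U_def algebra_simps)
    qed
  qed (simp_all add: F(1)[simplified])
qed

section \<open>Matrices with distinct eigenvalues\<close>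

text \<open>A Jordan block of size m makes its eigenvalue a root of order at least m. All roots are
  simple, so every block is 1 by 1.\<close>

lemma diagonalizable_if_distinct_eigenvalues:
  fixes A :: "real mat"
  assumes A: "A \<in> carrier_mat n n" and fin: "finite S"
    and char: "char_poly A = (\<Prod>s\<in>S. [:- s, 1:])"
  shows "diagonalizable A"
proof -
  obtain as where as: "set as = S" "distinct as" using finite_distinct_list[OF fin] by blast
  have "char_poly A = (\<Prod>a\<leftarrow>as. [:- a, 1:])"
    using prod.distinct_set_conv_list[OF as(2), of "\<lambda>a. [:- a, 1:]"] as(1) char by simp
  from jordan_nf_exists[OF A this] obtain n_as where jnf: "jordan_nf A n_as" by blast
  have nz: "char_poly A \<noteq> 0" unfolding char using fin by simp
  have one: "m = 1" if m: "(m, a) \<in> set n_as" for m a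
  proof -
    have "m \<noteq> 0" using jnf m by (force simp: jordan_nf_def)
    moreover have "m \<le> order a (char_poly A)"
      by (rule jordan_nf_block_size_order_bound[OF jnf m])
    moreover have "order a (char_poly A) \<le> 1"
    proof (cases "a \<in> S")
      case True
      have "poly (\<Prod>s\<in>S - {a}. [:- s, 1:]) a \<noteq> 0" using fin by (simp add: poly_prod)
      then have "order a ([:- a, 1:] * (\<Prod>s\<in>S - {a}. [:- s, 1:])) = order a [:- a, 1:]"
        using nz unfolding char prod.remove[OF fin True] by (metis add_0_right order_0I order_mult)
      then show ?thesis
        unfolding char prod.remove[OF fin True] using order_power_n_n[of a 1] by simp
    next
      case False
      then have "poly (char_poly A) a \<noteq> 0" unfolding char using fin by (auto simp: poly_prod)
      then show ?thesis by (simp add: order_0I)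
    qed
    ultimately show ?thesis by linarith
  qed
  have "jordan_matrix n_as = mk_diagonal (map snd n_as)"
    unfolding jordan_matrix_def mk_diagonal_def
    by (auto simp: jordan_block_def dest!: one intro!: arg_cong[of _ _ diag_block_mat] eq_matI)
  then have "diagonal_mat (jordan_matrix n_as)" by (simp add: mk_diagonal_diagonal)
  then show ?thesis using jnf unfolding diagonalizable_def jordan_nf_def by blast
qed

text \<open>Substituting x = u + \<alpha> \<xi> pulls one factor \<alpha> out of each linear
  factor.\<close>

lemma shifted_prod_roots:
  fixes \<alpha> :: real
  assumes "\<alpha> \<noteq> 0" and "card S = degree p" and "finite S" and "p \<noteq> 0"
    and "\<And>s. s \<in> S \<Longrightarrow> poly p s = 0"
  shows "(\<Prod>s\<in>S. x - (u + s * \<alpha>)) * lead_coeff p = \<alpha> ^ degree p * poly p ((x - u) / \<alpha>)"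
proof -
  have "poly p ((x - u) / \<alpha>) = lead_coeff p * (\<Prod>s\<in>S. (x - u) / \<alpha> - s)"
    using arg_cong[OF poly_eq_smult_prod_roots[of S p], of "\<lambda>q. poly q ((x - u) / \<alpha>)"] assms
    by (simp add: poly_prod)
  moreover have "(\<Prod>s\<in>S. x - (u + s * \<alpha>)) = \<alpha> ^ card S * (\<Prod>s\<in>S. (x - u) / \<alpha> - s)"
    unfolding prod_constant[symmetric] prod.distrib[symmetric]
    using assms(1) by (intro prod.cong) (auto simp: field_simps)
  ultimately show ?thesis by (simp add: assms(2))
qed

text \<open>No determinant is expanded: the characteristic polynomial is monic of degree n, so n
  distinct eigenvalues are all its roots.\<close>

lemma eigenvalues_imp_char_poly:
  fixes A :: "'a :: field mat"
  assumes A: "A \<in> carrier_mat n n" and "finite S" and "card S = n"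
    and "\<And>s. s \<in> S \<Longrightarrow> eigenvalue A s"
  shows "char_poly A = (\<Prod>s\<in>S. [:- s, 1:])"
proof -
  have deg: "degree (char_poly A) = n" "lead_coeff (char_poly A) = 1"
    using degree_monic_char_poly[OF A] by auto
  moreover have "char_poly A \<noteq> 0" using deg(2) by auto
  moreover have "poly (char_poly A) s = 0" if "s \<in> S" for s
    using assms(4)[OF that] eigenvalue_root_char_poly[OF A] by blast
  ultimately show ?thesis
    using poly_eq_smult_prod_roots[of S "char_poly A"] assms(2,3) by simp
qed

section \<open>Spectrum, characteristic polynomial and diagonalizability of the HSWME matrix\<close>

theorem theorem4p4:
  fixes N :: nat and g h u v \<alpha> \<beta> :: real
  assumes "N \<ge> 1" and "g > 0" and "h > 0" and "\<alpha> \<noteq> 0"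
  defines "A \<equiv> hswme_matrix N g h u v \<alpha> \<beta>"
  shows "diagonalizable A
    \<and> (\<forall>x. poly (char_poly A) x =
          fact N * fact (N + 1) / (real (odd_double_fact N))\<^sup>2 * \<alpha> ^ (2 * N + 1)
          * poly (pderiv (legendre (N + 1))) ((x - u) / \<alpha>)
          * poly (legendre (N + 1)) ((x - u) / \<alpha>)
          * ((x - u)\<^sup>2 - g * h - \<alpha>\<^sup>2))
    \<and> (\<exists>r s ev :: nat \<Rightarrow> real.
          bij_betw r {1..N} {\<xi>. poly (pderiv (legendre (N + 1))) \<xi> = 0}
        \<and> bij_betw s {1..N + 1} {\<xi>. poly (legendre (N + 1)) \<xi> = 0}
        \<and> ev 1 = u + sqrt (g * h + \<alpha>\<^sup>2)
        \<and> ev 2 = u - sqrt (g * h + \<alpha>\<^sup>2)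
        \<and> (\<forall>i\<in>{1..N}. ev (i + 2) = u + r i * \<alpha>)
        \<and> (\<forall>i\<in>{1..N + 1}. ev (i + N + 2) = u + s i * \<alpha>)
        \<and> spectrum A = ev ` {1..2 * N + 3}
        \<and> char_poly A = (\<Prod>k=1..2 * N + 3. [:- ev k, 1:]))"
proof -
  define w where "w = sqrt (g * h + \<alpha>\<^sup>2)"
  define R where "R = {\<xi>. poly (pderiv (bonnet (N + 1))) \<xi> = 0}"
  define S where "S = {\<xi>. poly (bonnet (N + 1)) \<xi> = 0}"
  \<comment> \<open>All eigenvalues are parametrised as u + \<xi> \<alpha>, so u + w and u - w
    correspond to w/\<alpha> and -w/\<alpha>.\<close>
  let ?T = "{w / \<alpha>, - (w / \<alpha>)}"
  define E where "E = (\<lambda>\<xi>. u + \<xi> * \<alpha>) ` (?T \<union> R \<union> S)"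
  have w2: "w\<^sup>2 = g * h + \<alpha>\<^sup>2" and w: "w > \<bar>\<alpha>\<bar>"
  proof -
    have "g * h > 0" using assms by simp
    then show "w\<^sup>2 = g * h + \<alpha>\<^sup>2" "w > \<bar>\<alpha>\<bar>"
      unfolding w_def by (simp_all add: real_less_rsqrt)
  qed
  have R: "card R = N" "R \<subseteq> {-1<..<1}" and S: "card S = N + 1" "S \<subseteq> {-1<..<1}"
    using pderiv_bonnet_roots[of N] bonnet_roots[of "N + 1"] by (simp_all add: R_def S_def del: bonnet.simps)
  \<comment> \<open>\<open>card\<close> is 0 on infinite sets, so finiteness follows from positive
    cardinality, for \<open>R\<close> by N >= 1.\<close>
  have fin: "finite R" "finite S"
    using R(1) S(1) assms(1) by (auto intro: card_ge_0_finite)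
  have RS: "R \<inter> S = {}" using bonnet_simple_roots by (auto simp: R_def S_def)
  \<comment> \<open>Since gh > 0 gives w > |\<alpha>|, both elements of \<open>?T\<close> lie
    outside (-1,1), where the other roots are.\<close>
  have T: "?T \<inter> (R \<union> S) = {}"
  proof -
    have "\<bar>w / \<alpha>\<bar> > 1" using w assms(4) by (simp add: abs_divide)
    then have "w / \<alpha> \<notin> {-1<..<1}" "- (w / \<alpha>) \<notin> {-1<..<1}" by auto
    then show ?thesis using R(2) S(2) by auto
  qed
  have "w / \<alpha> \<noteq> - (w / \<alpha>)" using w assms(4) by (auto simp: eq_neg_iff_add_eq_0)
  then have "card (?T \<union> R \<union> S) = 2 * N + 3"
    using R(1) S(1) T RS fin by (subst card_Un_disjoint; auto simp: card_Un_disjoint)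
  moreover have inj: "inj (\<lambda>\<xi>. u + \<xi> * \<alpha>)" using assms(4) by (auto intro: injI)
  ultimately have card_E: "card E = 2 * N + 3"
    unfolding E_def by (metis card_image inj_on_subset subset_UNIV)
  have fin_E: "finite E" using fin by (simp add: E_def)
  have A: "A \<in> carrier_mat (2 * N + 3) (2 * N + 3)" by (simp add: A_def hswme_matrix_def)
  have ev: "eigenvalue A e" if e: "e \<in> E" for e
  proof -
    obtain \<xi> where e: "e = u + \<xi> * \<alpha>" and \<xi>: "\<xi> \<in> ?T \<union> R \<union> S"
      using e unfolding E_def by blast
    show ?thesis
    proof (cases "\<xi> \<in> S")
      case True
      then show ?thesis
        unfolding e A_def by (intro hswme_eigenvalue_bonnet_root assms) (simp add: S_def)
    next
      case False
      \<comment> \<open>An element of \<open>?T\<close> kills the quadratic factor in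
        \<open>zero\<close>, an element of \<open>R\<close> the derivative.\<close>
      then have "(\<xi> * \<alpha>)\<^sup>2 = w\<^sup>2 \<or> \<xi> \<in> R" using \<xi> assms(4) by (auto simp: power_mult_distrib power_divide)
      with False show ?thesis
        unfolding e A_def w2 by (intro hswme_eigenvalue_nonroot assms) (auto simp: S_def R_def)
    qed
  qed
  have char: "char_poly A = (\<Prod>e\<in>E. [:- e, 1:])"
    by (rule eigenvalues_imp_char_poly[OF A fin_E card_E ev])
  have "poly (char_poly A) x = fact N * fact (N + 1) / (real (odd_double_fact N))\<^sup>2 * \<alpha> ^ (2 * N + 1)
          * poly (pderiv (bonnet (N + 1))) ((x - u) / \<alpha>) * poly (bonnet (N + 1)) ((x - u) / \<alpha>)
          * ((x - u)\<^sup>2 - g * h - \<alpha>\<^sup>2)" for x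
  proof -
    let ?D = "real (odd_double_fact N)"
    have pow: "\<alpha> ^ (2 * N + 1) = \<alpha> ^ N * \<alpha> ^ (N + 1)"
      by (simp flip: power_add add: mult_2)
    have D: "?D \<noteq> 0" by (simp add: odd_double_fact_def)
    have "poly (char_poly A) x = (\<Prod>\<xi>\<in>?T \<union> R \<union> S. x - (u + \<xi> * \<alpha>))"
      unfolding char E_def prod.reindex[OF inj_on_subset[OF inj subset_UNIV]]
      by (simp add: poly_prod algebra_simps)
    also have "\<dots> = (\<Prod>\<xi>\<in>?T. x - (u + \<xi> * \<alpha>)) * (\<Prod>\<xi>\<in>R. x - (u + \<xi> * \<alpha>)) * (\<Prod>\<xi>\<in>S. x - (u + \<xi> * \<alpha>))"
      using fin T RS by (subst prod.union_disjoint; (subst prod.union_disjoint)?; auto)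
    also have "(\<Prod>\<xi>\<in>?T. x - (u + \<xi> * \<alpha>)) = (x - u)\<^sup>2 - w\<^sup>2"
      using \<open>w / \<alpha> \<noteq> - (w / \<alpha>)\<close> assms(4) by (simp add: power2_eq_square algebra_simps)
    \<comment> \<open>The prefactor is the reciprocal of the leading coefficient, since the product
      itself is monic in x.\<close>
    also have "(\<Prod>\<xi>\<in>R. x - (u + \<xi> * \<alpha>))
        = fact N / ?D * (\<alpha> ^ N * poly (pderiv (bonnet (N + 1))) ((x - u) / \<alpha>))"
      using shifted_prod_roots[of \<alpha> R "pderiv (bonnet (N + 1))" x u] assms(4) R(1) fin D
        pderiv_bonnet_neq_0[of N] lead_coeff_pderiv_bonnet[of N] degree_pderiv_bonnet[of N]
      by (simp add: R_def field_simps del: bonnet.simps)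
    also have "(\<Prod>\<xi>\<in>S. x - (u + \<xi> * \<alpha>))
        = fact (N + 1) / ?D * (\<alpha> ^ (N + 1) * poly (bonnet (N + 1)) ((x - u) / \<alpha>))"
    proof -
      have "bonnet (N + 1) \<noteq> 0" using bonnet_at_1[of "N + 1"] by auto
      then have "(\<Prod>\<xi>\<in>S. x - (u + \<xi> * \<alpha>)) * (?D / fact (N + 1))
          = \<alpha> ^ (N + 1) * poly (bonnet (N + 1)) ((x - u) / \<alpha>)"
        using shifted_prod_roots[of \<alpha> S "bonnet (N + 1)" x u] assms(4) S(1) fin
          lead_coeff_bonnet[of N] degree_bonnet[of "N + 1"]
        by (simp add: S_def del: bonnet.simps fact_Suc)
      then show ?thesis using D by (simp add: divide_simps mult.commute del: bonnet.simps fact_Suc)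
    qed
    finally show ?thesis
      unfolding w2 pow diff_diff_eq[symmetric]
      by (simp add: power2_eq_square ac_simps del: bonnet.simps fact_Suc)
  qed
  moreover have "diagonalizable A"
    by (rule diagonalizable_if_distinct_eigenvalues[OF A fin_E char])
  moreover obtain r where r: "bij_betw r {1..N} R"
    using ex_bij_betw_nat_finite_1[OF fin(1)] R(1) by auto
  moreover obtain s where s: "bij_betw s {1..N + 1} S"
    using ex_bij_betw_nat_finite_1[OF fin(2)] S(1) by auto
  moreover define ev where "ev k = (if k = 1 then u + w else if k = 2 then u - w
      else if k \<le> N + 2 then u + r (k - 2) * \<alpha> else u + s (k - (N + 2)) * \<alpha>)" for k
  have ev_image: "ev ` {1..2 * N + 3} = E"
  proof -
    have "{1..2 * N + 3} = {1, 2} \<union> (\<lambda>i. i + 2) ` {1..N} \<union> (\<lambda>i. i + (N + 2)) ` {1..N + 1}"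
      unfolding image_add_atLeastAtMost' by auto
    then have "ev ` {1..2 * N + 3} = ev ` {1, 2} \<union> (\<lambda>i. ev (i + 2)) ` {1..N}
        \<union> (\<lambda>i. ev (i + (N + 2))) ` {1..N + 1}"
      by (simp only: image_Un image_image)
    also have "ev ` {1, 2} = (\<lambda>\<xi>. u + \<xi> * \<alpha>) ` ?T" using assms(4) by (simp add: ev_def insert_commute)
    also have "(\<lambda>i. ev (i + 2)) ` {1..N} = (\<lambda>\<xi>. u + \<xi> * \<alpha>) ` R"
      unfolding bij_betw_imp_surj_on[OF r, symmetric] image_image
      by (intro image_cong) (auto simp: ev_def)
    also have "(\<lambda>i. ev (i + (N + 2))) ` {1..N + 1} = (\<lambda>\<xi>. u + \<xi> * \<alpha>) ` S"
      unfolding bij_betw_imp_surj_on[OF s, symmetric] image_image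
      by (intro image_cong) (auto simp: ev_def)
    finally show ?thesis unfolding E_def image_Un .
  qed
  \<comment> \<open>Injectivity by counting: 2N + 3 indices have an image of 2N + 3 elements. The
    product over \<open>E\<close> can then be reindexed by k.\<close>
  have "inj_on ev {1..2 * N + 3}"
    by (rule eq_card_imp_inj_on, simp, unfold ev_image card_E, simp)
  then have "char_poly A = (\<Prod>k=1..2 * N + 3. [:- ev k, 1:])"
    unfolding char ev_image[symmetric] by (simp add: prod.reindex)
  moreover have "spectrum A = ev ` {1..2 * N + 3}"
    unfolding ev_image spectrum_def using eigenvalue_root_char_poly[OF A] fin_E
    by (auto simp: char poly_prod)
  moreover have "ev 1 = u + w" "ev 2 = u - w" "\<forall>i\<in>{1..N}. ev (i + 2) = u + r i * \<alpha>"
    "\<forall>i\<in>{1..N + 1}. ev (i + N + 2) = u + s i * \<alpha>"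
    by (auto simp: ev_def)
  ultimately show ?thesis
    unfolding legendre_eq_bonnet R_def S_def w_def by blast
qed

end
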